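(* Let $\mathcal{F}$ be a family of numerical semigroups, and let $\mathscr{A}(\mathcal{F})$ be the intersection of all arithmetic varieties containing $\mathcal{F}$. Then $\mathscr{A}(\mathcal{F})$ is the smallest (with respect to inclusion) arithmetic variety containing $\mathcal{F}$.
   Context: $\mathbb{N}$ denotes the set of non-negative integers. A numerical semigroup is a subset $S\subseteq\mathbb{N}$ containing $0$, closed under addition, with $\mathbb{N}\setminus S$ finite. For numerical semigroups $S,T$, $T$ is an arithmetic extension of $S$ if there exist positive integers $d_1,\dots,d_n$ ($n\ge 1$) such that $T=\{x\in\mathbb{N}\mid \{d_1x,\dots,d_nx\}\subset S\}$. An arithmetic variety is a non-empty family $\mathscr{A}$ of numerical semigroups such that (a) if $S,T\in\mathscr{A}$ then $S\cap T\in\mathscr{A}$; (b) if $S\in\mathscr{A}$ and $T$ is an arithmetic extension of $S$, then $T\in\mathscr{A}$. The set of all numerical semigroups is an arithmetic variety containing every family $\mathcal{F}$ of numerical semigroups. *)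

theory Defs
  imports Main
begin

definition numerical_semigroup :: "nat set \<Rightarrow> bool" where
  "numerical_semigroup S \<longleftrightarrow>
     0 \<in> S \<and> (\<forall>x\<in>S. \<forall>y\<in>S. x + y \<in> S) \<and> finite (UNIV - S)"

definition arithmetic_extension :: "nat set \<Rightarrow> nat set \<Rightarrow> bool" where
  "arithmetic_extension S T \<longleftrightarrow>
     numerical_semigroup S \<and> numerical_semigroup T \<and>
     (\<exists>n\<ge>1. \<exists>d :: nat \<Rightarrow> nat. (\<forall>i\<in>{1..n}. d i > 0) \<and>
        T = {x. {d i * x | i. i \<in> {1..n}} \<subseteq> S})"

definition arithmetic_variety :: "nat set set \<Rightarrow> bool" where
  "arithmetic_variety \<A> \<longleftrightarrow>
     \<A> \<noteq> {} \<and> (\<forall>S\<in>\<A>. numerical_semigroup S) \<and>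
     (\<forall>S\<in>\<A>. \<forall>T\<in>\<A>. S \<inter> T \<in> \<A>) \<and>
     (\<forall>S\<in>\<A>. \<forall>T. arithmetic_extension S T \<longrightarrow> T \<in> \<A>)"

text \<open>The intersection below is over a non-empty collection whenever every member of the
  family is a numerical semigroup, since the set of all numerical semigroups is then an
  arithmetic variety containing the family.\<close>

definition generated_variety :: "nat set set \<Rightarrow> nat set set" where
  "generated_variety \<F> = \<Inter> {\<A>. arithmetic_variety \<A> \<and> \<F> \<subseteq> \<A>}"

end

theory Submission
  imports Defs
begin

text \<open>All closure conditions on an arithmetic variety are universally quantified over its members,
  so they pass to intersections. Two points remain. Members of the intersection are numerical
  semigroups because there is at least one variety to intersect over, the family of all numerical
  semigroups (\<open>arithmetic_variety_all\<close>). The intersection is non-empty, even for an empty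
  generating family, because every variety contains \<open>\<nat>\<close>: a single multiplier exceeding all gaps
  of a member \<open>S\<close> sends every natural number into \<open>S\<close>, which makes \<open>\<nat>\<close> an arithmetic extension
  of \<open>S\<close> (\<open>UNIV_arithmetic_extension\<close>).\<close>

lemma numerical_semigroup_UNIV: "numerical_semigroup UNIV"
  by (simp add: numerical_semigroup_def)

lemma numerical_semigroup_Int:
  assumes "numerical_semigroup S" "numerical_semigroup T"
  shows "numerical_semigroup (S \<inter> T)"
  using assms by (simp add: numerical_semigroup_def Diff_Int)

lemma arithmetic_variety_all: "arithmetic_variety {S. numerical_semigroup S}"
  unfolding arithmetic_variety_def
  using numerical_semigroup_UNIV numerical_semigroup_Int
  by (auto simp: arithmetic_extension_def)

text \<open>The gaps of \<open>S\<close> are bounded, say by \<open>m\<close>. Multiplication by \<open>m + 1\<close> fixes \<open>0\<close>, which lies in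
  \<open>S\<close>, and moves every positive number beyond all gaps.\<close>

lemma UNIV_arithmetic_extension:
  assumes "numerical_semigroup S"
  shows "arithmetic_extension S UNIV"
proof -
  from assms have "finite (UNIV - S)" and zero: "0 \<in> S"
    by (auto simp: numerical_semigroup_def)
  then obtain m where gaps_le: "\<forall>x\<in>UNIV - S. x \<le> m"
    by (meson finite_nat_set_iff_bounded_le)
  have mult_in: "Suc m * x \<in> S" for x
  proof (cases x)
    case 0
    with zero show ?thesis by simp
  next
    case (Suc k)
    then have "\<not> Suc m * x \<le> m" by simp
    with gaps_le show ?thesis by blast
  qed
  have "(\<forall>i\<in>{1..1::nat}. Suc m > 0) \<and> UNIV = {x. {Suc m * x | i. i \<in> {1..1::nat}} \<subseteq> S}"
    using mult_in by auto
  then have "\<exists>n\<ge>1. \<exists>d :: nat \<Rightarrow> nat. (\<forall>i\<in>{1..n}. d i > 0) \<and>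
      UNIV = {x. {d i * x | i. i \<in> {1..n}} \<subseteq> S}"
    by (intro exI[of _ "1::nat"] conjI exI[of _ "\<lambda>_. Suc m"]) auto
  with assms numerical_semigroup_UNIV show ?thesis
    unfolding arithmetic_extension_def by blast
qed

lemma UNIV_in_arithmetic_variety:
  assumes "arithmetic_variety \<A>"
  shows "UNIV \<in> \<A>"
proof -
  from assms obtain S where "S \<in> \<A>" "numerical_semigroup S"
    unfolding arithmetic_variety_def by blast
  with assms UNIV_arithmetic_extension show ?thesis
    unfolding arithmetic_variety_def by blast
qed

lemma arithmetic_variety_Inter:
  assumes "\<V> \<noteq> {}" and varieties: "\<And>\<A>. \<A> \<in> \<V> \<Longrightarrow> arithmetic_variety \<A>"
  shows "arithmetic_variety (\<Inter>\<V>)"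
  unfolding arithmetic_variety_def
proof (intro conjI)
  show "\<Inter>\<V> \<noteq> {}"
    using varieties UNIV_in_arithmetic_variety by blast
  show "\<forall>S\<in>\<Inter>\<V>. numerical_semigroup S"
    using assms unfolding arithmetic_variety_def by blast
  show "\<forall>S\<in>\<Inter>\<V>. \<forall>T\<in>\<Inter>\<V>. S \<inter> T \<in> \<Inter>\<V>"
    using varieties unfolding arithmetic_variety_def by blast
  show "\<forall>S\<in>\<Inter>\<V>. \<forall>T. arithmetic_extension S T \<longrightarrow> T \<in> \<Inter>\<V>"
    using varieties unfolding arithmetic_variety_def by blast
qed

theorem proposition4:
  fixes \<F> :: "nat set set"
  assumes "\<forall>S\<in>\<F>. numerical_semigroup S"
  shows "arithmetic_variety (generated_variety \<F>) \<and>
         \<F> \<subseteq> generated_variety \<F> \<and>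
         (\<forall>\<A>. arithmetic_variety \<A> \<and> \<F> \<subseteq> \<A> \<longrightarrow> generated_variety \<F> \<subseteq> \<A>)"
proof (intro conjI)
  have "{S. numerical_semigroup S} \<in> {\<A>. arithmetic_variety \<A> \<and> \<F> \<subseteq> \<A>}"
    using assms arithmetic_variety_all by blast
  then show "arithmetic_variety (generated_variety \<F>)"
    unfolding generated_variety_def by (intro arithmetic_variety_Inter) blast+
  show "\<F> \<subseteq> generated_variety \<F>"
    unfolding generated_variety_def by blast
  show "\<forall>\<A>. arithmetic_variety \<A> \<and> \<F> \<subseteq> \<A> \<longrightarrow> generated_variety \<F> \<subseteq> \<A>"
    unfolding generated_variety_def by blast
qed

end
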